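(* Let $RSC_n=RSC(n,p_1,p_2,p_3)$ be a random spiro chain and let $R_n=\sum_{uv\in E(RSC_n)}(d_ud_v)^{-1/2}$ be the Randić index of $RSC_n$, with $n\ge2$. Then $$R_n=2-\sqrt2+\left(\tfrac34-\tfrac{\sqrt2}{2}\right)X+(1+\sqrt2)n,$$ $$\mathbb{E}(R_n)=2-\sqrt2+\left(\left(\tfrac34-\tfrac{\sqrt2}{2}\right)p_1+1+\sqrt2\right)n+\left(\sqrt2-\tfrac32\right)p_1,$$ $$V(R_n)=\left(\tfrac34-\tfrac{\sqrt2}{2}\right)^2p_1(1-p_1)(n-2),$$ where $X$ is a random variable having the binomial distribution with parameters $n-2$ and $p_1$; moreover, as $n\to\infty$, $$\frac{R_n-\mathbb{E}(R_n)}{\sqrt{V(R_n)}}\xrightarrow{D}N(0,1).$$ Here $\mathbb{E}$ and $V$ denote expectation and variance, $\xrightarrow{D}$ convergence in distribution, and $N(0,1)$ the standard normal distribution.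
   Context: For a finite simple graph $G$, $E(G)$ is its edge set and $d_v$ is the degree of the vertex $v$. Random spiro chain. Fix $p_1,p_2,p_3$ with $0<p_i<1$ and $p_1+p_2+p_3=1$. The random spiro chain $RSC_n=RSC(n,p_1,p_2,p_3)$ with $n$ hexagons is built as follows. $RSC_1$ is a hexagon $H_1$ (a 6-cycle). $RSC_2$ consists of two hexagons $H_1,H_2$ sharing exactly one vertex. For $n>2$, $RSC_n$ is obtained from $RSC_{n-1}$ by attaching a new hexagon $H_n$ to the last hexagon $H_{n-1}$, identifying one vertex of $H_n$ with a vertex $w$ of $H_{n-1}$, where $w$ is at distance $i\in\{1,2,3\}$ (in the 6-cycle $H_{n-1}$) from the vertex that $H_{n-1}$ shares with $H_{n-2}$. Case $i$ is chosen with probability $p_i$, independently of the previous choices. The first identity asserts that such a random variable $X$ exists (on the same probability space as the chain). *)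

theory Defs
  imports "HOL-Probability.Probability"
begin

text \<open>A graph is given by its vertex set and its set of edges, an edge being the set of its two ends.\<close>

record 'v graph =
  verts :: "'v set"
  edges :: "'v set set"

definition degree :: "'v graph \<Rightarrow> 'v \<Rightarrow> nat" where
  "degree G v = card {e \<in> edges G. v \<in> e}"

text \<open>For an edge \<open>e = {u, v}\<close> of a simple graph, the inner product is \<open>d\<^sub>u d\<^sub>v\<close>.\<close>

definition randic_index :: "'v graph \<Rightarrow> real" where
  "randic_index G = (\<Sum>e\<in>edges G. (\<Prod>v\<in>e. real (degree G v)) powr (- 1 / 2))"

definition graph_dist :: "'v graph \<Rightarrow> 'v \<Rightarrow> 'v \<Rightarrow> nat" where
  "graph_dist G u v = (LEAST k. (u, v) \<in> {(x, y). {x, y} \<in> edges G} ^^ k)"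

definition hexagon :: "'v graph \<Rightarrow> bool" where
  "hexagon G \<longleftrightarrow> (\<exists>f :: nat \<Rightarrow> 'v. inj_on f {..<6} \<and> verts G = f ` {..<6} \<and>
     edges G = {{f i, f ((i + 1) mod 6)} | i. i < 6})"

text \<open>The union of the first \<open>n\<close> members \<open>H 1, \<dots>, H n\<close> of a sequence of graphs.\<close>

definition chain_graph :: "(nat \<Rightarrow> 'v graph) \<Rightarrow> nat \<Rightarrow> 'v graph" where
  "chain_graph H n =
     \<lparr>verts = (\<Union>k\<in>{1..n}. verts (H k)), edges = (\<Union>k\<in>{1..n}. edges (H k))\<rparr>"

text \<open>
  \<open>H k\<close> is the \<open>k\<close>-th hexagon (\<open>k \<ge> 1\<close>) and \<open>s k\<close> (\<open>k \<ge> 2\<close>) is the vertex it shares with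
  \<open>H (k - 1)\<close>; values at smaller indices are irrelevant. Any of the vertices of \<open>H (k - 1)\<close>
  at the relevant distance from \<open>s (k - 1)\<close> may serve as \<open>s k\<close>.
\<close>

definition attach_dist :: "(nat \<Rightarrow> 'v graph) \<Rightarrow> (nat \<Rightarrow> 'v) \<Rightarrow> nat \<Rightarrow> nat" where
  "attach_dist H s n = graph_dist (H (n - 1)) (s (n - 1)) (s n)"

definition spiro_chain :: "(nat \<Rightarrow> 'v graph) \<Rightarrow> (nat \<Rightarrow> 'v) \<Rightarrow> bool" where
  "spiro_chain H s \<longleftrightarrow>
     (\<forall>n\<ge>1. hexagon (H n)) \<and>
     (\<forall>n\<ge>2. s n \<in> verts (H (n - 1)) \<and> verts (chain_graph H (n - 1)) \<inter> verts (H n) = {s n}) \<and>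
     (\<forall>n\<ge>3. attach_dist H s n \<in> {1, 2, 3})"

text \<open>
  Only the distances carry a probabilistic hypothesis; which of the equidistant vertices is used,
  and how vertices are named, may depend on the outcome in an arbitrary way.
\<close>

locale random_spiro_chain = prob_space M for M :: "'a measure" +
  fixes p1 p2 p3 :: real
    and H :: "nat \<Rightarrow> 'a \<Rightarrow> 'v graph"
    and s :: "nat \<Rightarrow> 'a \<Rightarrow> 'v"
  assumes p1: "0 < p1" "p1 < 1"
    and p2: "0 < p2" "p2 < 1"
    and p3: "0 < p3" "p3 < 1"
    and p_sum: "p1 + p2 + p3 = 1"
    and chain: "\<And>\<omega>. \<omega> \<in> space M \<Longrightarrow> spiro_chain (\<lambda>k. H k \<omega>) (\<lambda>k. s k \<omega>)"
    and indep: "indep_vars (\<lambda>_. count_space UNIV)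
                  (\<lambda>n \<omega>. attach_dist (\<lambda>k. H k \<omega>) (\<lambda>k. s k \<omega>) n) {3..}"
    and prob1: "\<And>n. n \<ge> 3 \<Longrightarrow>
          prob {\<omega> \<in> space M. attach_dist (\<lambda>k. H k \<omega>) (\<lambda>k. s k \<omega>) n = 1} = p1"
    and prob2: "\<And>n. n \<ge> 3 \<Longrightarrow>
          prob {\<omega> \<in> space M. attach_dist (\<lambda>k. H k \<omega>) (\<lambda>k. s k \<omega>) n = 2} = p2"
    and prob3: "\<And>n. n \<ge> 3 \<Longrightarrow>
          prob {\<omega> \<in> space M. attach_dist (\<lambda>k. H k \<omega>) (\<lambda>k. s k \<omega>) n = 3} = p3"

definition RSC :: "(nat \<Rightarrow> 'a \<Rightarrow> 'v graph) \<Rightarrow> nat \<Rightarrow> 'a \<Rightarrow> 'v graph" where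
  "RSC H n \<omega> = chain_graph (\<lambda>k. H k \<omega>) n"

end

theory Submission
  imports Defs
begin

text \<open>
  Consecutive hexagons of a spiro chain share exactly one vertex, hexagons further apart share
  none, and distinct hexagons have no common edge. Hence every vertex has degree \<open>2\<close>, except that
  the \<open>n - 1\<close> shared vertices have degree \<open>4\<close>, and the Randic index is a sum over the hexagons of a
  contribution that depends only on where the shared vertices lie in that hexagon. An end hexagon
  contains one of them and contributes \<open>2 + sqrt 2 / 2\<close>. An inner hexagon contains two of them:
  if they are not adjacent, four of its edges join degrees \<open>2\<close> and \<open>4\<close> and two join degrees \<open>2\<close>
  and \<open>2\<close>, so it contributes \<open>1 + sqrt 2\<close>; if they are adjacent, its edges have degree products
  \<open>16, 8, 8, 4, 4, 4\<close> and it contributes \<open>3 / 4 - sqrt 2 / 2\<close> more. The deterministic formula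
  (\<open>randic_index_chain\<close>) follows, with \<open>X\<close> the number of attachments at distance \<open>1\<close>.

  In the random chain these attachments are independent events of probability \<open>p1\<close>, one for each of
  the steps \<open>3, \<dots>, n\<close>, so \<open>X\<close> is binomial (\<open>distr_card_indep_binomial\<close>). As the index is an affine
  function of \<open>X\<close>, its mean and variance are those of the binomial distribution transported by this
  function (\<open>affine_binomial_moments\<close>). The slope \<open>3 / 4 - sqrt 2 / 2\<close> is positive, so the
  standardised index equals the standardised count, for which the central limit theorem for
  independent indicators applies (\<open>de_Moivre_Laplace\<close>).
\<close>

section \<open>Hexagons\<close>

text \<open>Reading the cycle from a chosen vertex turns every later statement about a hexagon and one of its
  vertices into a finite check on six distinct names.\<close>
lemma hexagon_cycle_at:
  assumes "hexagon G" "v \<in> verts G"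
  obtains a b c d e where "distinct [v, a, b, c, d, e]" "verts G = {v, a, b, c, d, e}"
    "edges G = {{v, a}, {a, b}, {b, c}, {c, d}, {d, e}, {e, v}}"
proof -
  obtain f :: "nat \<Rightarrow> 'a" where f: "inj_on f {..<6}" "verts G = f ` {..<6}"
    "edges G = {{f i, f ((i + 1) mod 6)} | i. i < 6}"
    using assms(1) unfolding hexagon_def by blast
  have lt6: "{..<6::nat} = {0, 1, 2, 3, 4, 5}"
    by auto
  have "distinct (map f [0, 1, 2, 3, 4, 5])"
    using f(1) by (subst distinct_map) (simp add: lt6)
  then have dist: "distinct [f 0, f 1, f 2, f 3, f 4, f 5]"
    by (simp only: list.map)
  have V: "verts G = {f 0, f 1, f 2, f 3, f 4, f 5}"
    unfolding f(2) lt6 by simp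
  have "edges G = (\<lambda>i. {f i, f ((i + 1) mod 6)}) ` {..<6}"
    unfolding f(3) by auto
  then have E: "edges G = {{f 0, f 1}, {f 1, f 2}, {f 2, f 3}, {f 3, f 4}, {f 4, f 5}, {f 5, f 0}}"
    unfolding lt6 by (simp del: One_nat_def)
  \<comment> \<open>The six possible positions of \<open>v\<close> are the six rotations of the cycle.\<close>
  from assms(2) V consider "v = f 0" | "v = f 1" | "v = f 2" | "v = f 3" | "v = f 4" | "v = f 5"
    by auto
  then show thesis
  proof cases
    case 1
    then show ?thesis
      by (intro that[of "f 1" "f 2" "f 3" "f 4" "f 5"]) (use dist V E in auto)
  next
    case 2
    then show ?thesis
      by (intro that[of "f 2" "f 3" "f 4" "f 5" "f 0"]) (use dist V E in auto)
  next
    case 3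
    then show ?thesis
      by (intro that[of "f 3" "f 4" "f 5" "f 0" "f 1"]) (use dist V E in auto)
  next
    case 4
    then show ?thesis
      by (intro that[of "f 4" "f 5" "f 0" "f 1" "f 2"]) (use dist V E in auto)
  next
    case 5
    then show ?thesis
      by (intro that[of "f 5" "f 0" "f 1" "f 2" "f 3"]) (use dist V E in auto)
  next
    case 6
    then show ?thesis
      by (intro that[of "f 0" "f 1" "f 2" "f 3" "f 4"]) (use dist V E in auto)
  qed
qed

lemma hexagon_nonempty:
  assumes "hexagon G"
  obtains v where "v \<in> verts G"
  using assms lessThan_iff[of 0 "6::nat"] unfolding hexagon_def by fastforce

lemma hexagon_finite_edges:
  assumes "hexagon G"
  shows "finite (edges G)"
  by (rule hexagon_nonempty[OF assms], rule hexagon_cycle_at[OF assms]) auto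

lemma hexagon_edge:
  assumes "hexagon G" "e \<in> edges G"
  shows "e \<subseteq> verts G" "card e = 2"
proof -
  obtain v where v: "v \<in> verts G"
    using assms(1) by (rule hexagon_nonempty)
  have "e \<subseteq> verts G \<and> card e = 2"
    by (rule hexagon_cycle_at[OF assms(1) v]) (use assms(2) in \<open>auto simp: card_2_iff doubleton_eq_iff\<close>)
  then show "e \<subseteq> verts G" "card e = 2"
    by auto
qed

lemma hexagon_degree:
  assumes "hexagon G"
  shows "degree G v = (if v \<in> verts G then 2 else 0)"
proof (cases "v \<in> verts G")
  case True
  obtain a b c d e where cyc: "distinct [v, a, b, c, d, e]"
    "edges G = {{v, a}, {a, b}, {b, c}, {c, d}, {d, e}, {e, v}}"
    by (rule hexagon_cycle_at[OF assms True])
  then have "{x \<in> edges G. v \<in> x} = {{v, a}, {e, v}}"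
    by auto
  then show ?thesis
    using True cyc(1) by (simp add: degree_def doubleton_eq_iff)
next
  case False
  then have "{x \<in> edges G. v \<in> x} = {}"
    using hexagon_edge(1)[OF assms] by auto
  then have "card {x \<in> edges G. v \<in> x} = 0"
    by (simp only: card.empty)
  then show ?thesis
    using False by (simp add: degree_def)
qed

text \<open>The distance is a least walk length. Connectedness of the hexagon is what makes this minimum
  attained, so that the value \<open>1\<close> certifies a walk of length \<open>1\<close>.\<close>
lemma hexagon_dist_1_iff:
  assumes "hexagon G" "u \<in> verts G" "w \<in> verts G" "u \<noteq> w"
  shows "graph_dist G u w = 1 \<longleftrightarrow> {u, w} \<in> edges G"
proof -
  define r where "r = {(x, y). {x, y} \<in> edges G}"
  have dist: "graph_dist G u w = (LEAST k. (u, w) \<in> r ^^ k)"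
    by (simp add: graph_dist_def r_def)
  obtain a b c d e where V: "verts G = {u, a, b, c, d, e}"
    and E: "edges G = {{u, a}, {a, b}, {b, c}, {c, d}, {d, e}, {e, u}}"
    by (rule hexagon_cycle_at[OF assms(1,2)])
  have "(u, a) \<in> r" "(a, b) \<in> r" "(b, c) \<in> r" "(c, d) \<in> r" "(d, e) \<in> r"
    by (simp_all add: r_def E)
  then have "(u, w) \<in> r\<^sup>*"
    using assms(3,4) unfolding V by (auto intro: rtrancl_into_rtrancl)
  then obtain k where "(u, w) \<in> r ^^ k"
    by (auto simp: rtrancl_power)
  then have least: "(u, w) \<in> r ^^ (LEAST k. (u, w) \<in> r ^^ k)"
    by (rule LeastI)
  show ?thesis
  proof
    assume "graph_dist G u w = 1"
    then have "(u, w) \<in> r ^^ 1"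
      using least by (simp only: dist)
    then show "{u, w} \<in> edges G"
      by (simp add: r_def)
  next
    assume "{u, w} \<in> edges G"
    then have "(u, w) \<in> r ^^ 1"
      by (simp add: r_def)
    moreover have "1 \<le> k" if "(u, w) \<in> r ^^ k" for k
      using that assms(4) by (cases k) auto
    ultimately show "graph_dist G u w = 1"
      unfolding dist by (rule Least_equality)
  qed
qed

section \<open>The contribution of one hexagon\<close>

text \<open>The ends of an edge of a spiro chain have degrees \<open>2\<close> or \<open>4\<close>, so their product is \<open>4\<close>, \<open>8\<close> or
  \<open>16\<close>.\<close>
lemma powr_minus_half:
  "4 powr (- 1 / 2) = (1 / 2 :: real)" "8 powr (- 1 / 2) = sqrt 2 / 4"
  "16 powr (- 1 / 2) = (1 / 4 :: real)"
proof -
  have *: "x powr (- 1 / 2) = 1 / sqrt x" if "x > 0" for x :: real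
    using that powr_minus_divide[of x "1/2"] powr_half_sqrt[of x] by simp
  have s8: "sqrt 8 = 2 * sqrt 2"
    using real_sqrt_mult[of 4 2] by simp
  have s4: "sqrt 4 = 2" and s16: "sqrt 16 = 4"
    by (simp_all add: real_sqrt_unique)
  show "4 powr (- 1 / 2) = (1 / 2 :: real)"
    using *[of 4] by (simp add: s4)
  show "8 powr (- 1 / 2) = sqrt 2 / 4"
  proof -
    have "1 / (2 * sqrt 2) = sqrt 2 / 4"
      by (simp add: field_simps)
    then show ?thesis
      using *[of 8] by (simp add: s8)
  qed
  show "16 powr (- 1 / 2) = (1 / 4 :: real)"
    using *[of 16] by (simp add: s16)
qed

text \<open>The summand of the Randic index with the degree function as a parameter: the contribution of a
  hexagon is then a statement about that hexagon and the degrees which the surrounding chain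
  induces on its vertices.\<close>
definition edge_weight :: "('v \<Rightarrow> nat) \<Rightarrow> 'v set \<Rightarrow> real" where
  "edge_weight d e = (\<Prod>v\<in>e. real (d v)) powr (- 1 / 2)"

lemma edge_weight_pair: "u \<noteq> v \<Longrightarrow> edge_weight d {u, v} = (real (d u) * real (d v)) powr (- 1 / 2)"
  by (simp add: edge_weight_def)

lemma hexagon_sum:
  assumes "distinct [v, a, b, c, d, e]" "edges G = {{v, a}, {a, b}, {b, c}, {c, d}, {d, e}, {e, v}}"
  shows "sum h (edges G) = h {v, a} + h {a, b} + h {b, c} + h {c, d} + h {d, e} + (h {e, v} :: real)"
proof -
  have "distinct [e, d, c, b, a, v]"
    using assms(1) by auto
  with assms(1) show ?thesis
    unfolding assms(2) by (simp add: doubleton_eq_iff)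
qed

text \<open>The two edges at \<open>s\<close> have degree product \<open>8\<close>, the other four have degree product \<open>4\<close>.\<close>
lemma end_hexagon_weight:
  assumes "hexagon G" "s \<in> verts G"
    and deg: "\<And>v. v \<in> verts G \<Longrightarrow> D v = (if v = s then 4 else 2 :: nat)"
  shows "(\<Sum>e\<in>edges G. edge_weight D e) = 2 + sqrt 2 / 2"
proof -
  obtain a b c d e where dis: "distinct [s, a, b, c, d, e]" and V: "verts G = {s, a, b, c, d, e}"
    and E: "edges G = {{s, a}, {a, b}, {b, c}, {c, d}, {d, e}, {e, s}}"
    by (rule hexagon_cycle_at[OF assms(1,2)])
  have dis': "distinct [e, d, c, b, a, s]"
    using dis by auto
  have "D s = 4" "D a = 2" "D b = 2" "D c = 2" "D d = 2" "D e = 2"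
    using dis dis' by (simp_all add: deg V)
  then show ?thesis
    unfolding hexagon_sum[OF dis E] using dis dis'
    by (simp add: edge_weight_pair powr_minus_half[unfolded divide_minus_left])
qed

text \<open>Beyond adjacency, the distance of \<open>s\<close> and \<open>t\<close> has no influence: without an edge between them, each is
  the end of two edges to vertices of degree \<open>2\<close>, whether they are opposite or have a common
  neighbour. This is why the distances \<open>2\<close> and \<open>3\<close> give the same Randic index.\<close>
lemma inner_hexagon_weight:
  assumes "hexagon G" "s \<in> verts G" "t \<in> verts G" "s \<noteq> t"
    and deg: "\<And>v. v \<in> verts G \<Longrightarrow> D v = (if v = s \<or> v = t then 4 else 2 :: nat)"
  shows "(\<Sum>e\<in>edges G. edge_weight D e) =
    1 + sqrt 2 + (if {s, t} \<in> edges G then 3 / 4 - sqrt 2 / 2 else 0)"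
proof -
  obtain a b c d e where dis: "distinct [s, a, b, c, d, e]" and V: "verts G = {s, a, b, c, d, e}"
    and E: "edges G = {{s, a}, {a, b}, {b, c}, {c, d}, {d, e}, {e, s}}"
    by (rule hexagon_cycle_at[OF assms(1,2)])
  \<comment> \<open>The reversed list gives the simplifier the inequalities in the opposite orientation.\<close>
  have dis': "distinct [e, d, c, b, a, s]"
    using dis by auto
  have D: "D x = (if x = s \<or> x = t then 4 else 2)" if "x \<in> {s, a, b, c, d, e}" for x
    using deg that V by simp
  have adj: "{s, t} \<in> edges G \<longleftrightarrow> t = a \<or> t = e"
    using dis assms(4) by (auto simp: E doubleton_eq_iff)
  consider "t = a" | "t = b" | "t = c" | "t = d" | "t = e"
    using assms(3,4) V by auto
  then show ?thesis
    unfolding hexagon_sum[OF dis E] adj using dis dis'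
    by cases (simp_all add: edge_weight_pair D powr_minus_half[unfolded divide_minus_left])
qed

section \<open>Degrees and the Randic index of a spiro chain\<close>
context
  fixes H :: "nat \<Rightarrow> 'v graph" and s :: "nat \<Rightarrow> 'v"
  assumes chain: "spiro_chain H s"
begin

lemma chain_hexagon: "1 \<le> k \<Longrightarrow> hexagon (H k)"
  using chain unfolding spiro_chain_def by blast

lemma cut_vertex_mem: "1 \<le> k \<Longrightarrow> s (Suc k) \<in> verts (H k)" "2 \<le> k \<Longrightarrow> s k \<in> verts (H k)"
proof -
  assume "1 \<le> k"
  then have "2 \<le> Suc k" by simp
  then have "s (Suc k) \<in> verts (H (Suc k - 1))"
    using chain unfolding spiro_chain_def by blast
  then show "s (Suc k) \<in> verts (H k)" by simp
next
  assume "2 \<le> k"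
  then have "verts (chain_graph H (k - 1)) \<inter> verts (H k) = {s k}"
    using chain unfolding spiro_chain_def by blast
  then show "s k \<in> verts (H k)" by auto
qed

lemma shared_vertex:
  assumes "1 \<le> i" "i < j" "v \<in> verts (H i)" "v \<in> verts (H j)"
  shows "v = s j"
proof -
  have "2 \<le> j" using assms by simp
  then have "verts (chain_graph H (j - 1)) \<inter> verts (H j) = {s j}"
    using chain unfolding spiro_chain_def by blast
  moreover have "v \<in> verts (chain_graph H (j - 1))"
    using assms unfolding chain_graph_def by auto
  ultimately show ?thesis
    using assms(4) by auto
qed

text \<open>Equal shared vertices would be at distance \<open>0\<close>, but attachment distances are \<open>1\<close>, \<open>2\<close> or \<open>3\<close>.\<close>
lemma cut_vertices_distinct:
  assumes "2 \<le> k"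
  shows "s k \<noteq> s (Suc k)"
proof
  assume eq: "s k = s (Suc k)"
  have "(s k, s k) \<in> {(x, y). {x, y} \<in> edges (H k)} ^^ 0"
    by simp
  then have "graph_dist (H k) (s k) (s k) = 0"
    unfolding graph_dist_def by (simp add: Least_eq_0)
  moreover have "3 \<le> Suc k" using assms by simp
  then have "attach_dist H s (Suc k) \<in> {1, 2, 3}"
    using chain unfolding spiro_chain_def by blast
  ultimately show False
    by (simp add: attach_dist_def flip: eq)
qed

text \<open>A common vertex of \<open>H i\<close> and \<open>H j\<close> must be \<open>s j\<close>, which lies in \<open>H (j - 1)\<close>. As it also lies in the
  earlier \<open>H i\<close>, it must be \<open>s (j - 1)\<close> too, contradicting the previous lemma.\<close>
lemma non_consecutive_disjoint:
  assumes "1 \<le> i" "Suc i < j"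
  shows "verts (H i) \<inter> verts (H j) = {}"
proof (rule ccontr)
  assume "verts (H i) \<inter> verts (H j) \<noteq> {}"
  then obtain v where v: "v \<in> verts (H i)" "v \<in> verts (H j)" by auto
  obtain k where k: "j = Suc k" "i < k" "2 \<le> k"
    using assms by (cases j) auto
  have "v = s j"
    using shared_vertex[of i j v] v assms by simp
  moreover from this have "v \<in> verts (H k)"
    using cut_vertex_mem(1)[of k] k by simp
  then have "v = s k"
    using shared_vertex[of i k v] v assms k by simp
  ultimately show False
    using cut_vertices_distinct[of k] k by simp
qed

text \<open>Two hexagons have at most one vertex in common, and an edge has two.\<close>
lemma edges_disjoint:
  assumes "1 \<le> i" "1 \<le> j" "i \<noteq> j"
  shows "edges (H i) \<inter> edges (H j) = {}"
proof -
  have "edges (H i) \<inter> edges (H j) = {}" if "1 \<le> i" "i < j" for i j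
  proof (rule ccontr)
    assume "edges (H i) \<inter> edges (H j) \<noteq> {}"
    then obtain e where "e \<in> edges (H i)" "e \<in> edges (H j)" by auto
    then have "e \<subseteq> verts (H i)" "e \<subseteq> verts (H j)" "card e = 2"
      using hexagon_edge[OF chain_hexagon] that by auto
    moreover from this have "e \<subseteq> {s j}"
      using shared_vertex[OF that] by blast
    then have "card e \<le> card {s j}"
      by (rule card_mono[rotated]) simp
    ultimately show False by simp
  qed
  from this[of i j] this[of j i] show ?thesis
    using assms by (cases "i < j") auto
qed

lemma hexagons_containing:
  assumes "1 \<le> k" "k \<le> n" "v \<in> verts (H k)"
  shows "{j \<in> {1..n}. v \<in> verts (H j)} =
    {k} \<union> (if 2 \<le> k \<and> v = s k then {k - 1} else {})
        \<union> (if k < n \<and> v = s (Suc k) then {Suc k} else {})" (is "?L = ?R")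
proof (intro equalityI subsetI)
  fix j assume "j \<in> ?L"
  then have j: "1 \<le> j" "j \<le> n" "v \<in> verts (H j)" by auto
  have "\<not> Suc j < k" "\<not> Suc k < j"
    using non_consecutive_disjoint[of j k] non_consecutive_disjoint[of k j] assms j by auto
  then consider "j = k" | "Suc j = k" | "j = Suc k" by linarith
  then show "j \<in> ?R"
  proof cases
    case 2
    then have "v = s k" using shared_vertex[of j k v] assms j by simp
    then show ?thesis using 2 j by auto
  next
    case 3
    then have "v = s j" using shared_vertex[of k j v] assms j by simp
    then show ?thesis using 3 j by auto
  qed simp
next
  fix j assume "j \<in> ?R"
  then consider "j = k" | "2 \<le> k" "v = s k" "j = k - 1" | "k < n" "v = s (Suc k)" "j = Suc k"
    by (auto split: if_splits)
  then show "j \<in> ?L"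
  proof cases
    case 2
    then show ?thesis using cut_vertex_mem(1)[of "k - 1"] assms by auto
  next
    case 3
    then show ?thesis using cut_vertex_mem(2)[of "Suc k"] assms by auto
  qed (use assms in auto)
qed

text \<open>Since no edge is counted twice, degrees add up over the hexagons; each hexagon then contributes
  \<open>2\<close> at its own vertices.\<close>
lemma degree_chain_sum: "degree (chain_graph H n) v = (\<Sum>j\<in>{1..n}. degree (H j) v)"
proof -
  have "{e \<in> edges (chain_graph H n). v \<in> e} = (\<Union>j\<in>{1..n}. {e \<in> edges (H j). v \<in> e})"
    by (auto simp: chain_graph_def)
  moreover have "card (\<Union>j\<in>{1..n}. {e \<in> edges (H j). v \<in> e}) =
      (\<Sum>j\<in>{1..n}. card {e \<in> edges (H j). v \<in> e})"
  proof (intro card_UN_disjoint ballI impI)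
    fix i j assume ij: "i \<in> {1..n}" "j \<in> {1..n}" "i \<noteq> j"
    then have "edges (H i) \<inter> edges (H j) = {}"
      by (intro edges_disjoint) auto
    then show "{e \<in> edges (H i). v \<in> e} \<inter> {e \<in> edges (H j). v \<in> e} = {}"
      by blast
  qed (use hexagon_finite_edges[OF chain_hexagon] in auto)
  ultimately show ?thesis
    by (simp add: degree_def)
qed

lemma degree_chain:
  assumes "1 \<le> k" "k \<le> n" "v \<in> verts (H k)"
  shows "degree (chain_graph H n) v =
    (if (2 \<le> k \<and> v = s k) \<or> (k < n \<and> v = s (Suc k)) then 4 else 2)"
proof -
  have "degree (chain_graph H n) v = (\<Sum>j\<in>{1..n}. if v \<in> verts (H j) then 2 else 0)"
    unfolding degree_chain_sum by (intro sum.cong) (auto simp: hexagon_degree chain_hexagon)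
  also have "\<dots> = 2 * card {j \<in> {1..n}. v \<in> verts (H j)}"
    by (subst sum.inter_filter[symmetric]) auto
  also have "\<dots> = (if (2 \<le> k \<and> v = s k) \<or> (k < n \<and> v = s (Suc k)) then 4 else 2)"
    unfolding hexagons_containing[OF assms] using cut_vertices_distinct[of k] by auto
  finally show ?thesis .
qed

lemma randic_chain_sum:
  "randic_index (chain_graph H n) =
    (\<Sum>k\<in>{1..n}. \<Sum>e\<in>edges (H k). edge_weight (degree (chain_graph H n)) e)"
proof -
  have "randic_index (chain_graph H n) =
      (\<Sum>e\<in>(\<Union>k\<in>{1..n}. edges (H k)). edge_weight (degree (chain_graph H n)) e)"
    by (simp add: randic_index_def edge_weight_def chain_graph_def)
  also have "\<dots> = (\<Sum>k\<in>{1..n}. \<Sum>e\<in>edges (H k). edge_weight (degree (chain_graph H n)) e)"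
    by (intro sum.UNION_disjoint)
      (auto intro!: hexagon_finite_edges chain_hexagon simp: edges_disjoint)
  finally show ?thesis .
qed

text \<open>The two ends contribute \<open>4 + sqrt 2\<close> together and the \<open>n - 2\<close> inner hexagons \<open>1 + sqrt 2\<close> each, plus
  \<open>3 / 4 - sqrt 2 / 2\<close> for each of them whose two shared vertices are adjacent. The hexagon \<open>H k\<close>
  is responsible for the attachment distance at step \<open>k + 1\<close>, hence the range \<open>3, \<dots>, n\<close>.\<close>
theorem randic_index_chain:
  assumes "2 \<le> n"
  shows "randic_index (chain_graph H n) =
    2 - sqrt 2 + (3 / 4 - sqrt 2 / 2) * real (card {k \<in> {3..n}. attach_dist H s k = 1})
      + (1 + sqrt 2) * real n"
proof -
  define w where "w k = (\<Sum>e\<in>edges (H k). edge_weight (degree (chain_graph H n)) e)" for k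
  have first: "w 1 = 2 + sqrt 2 / 2"
    unfolding w_def
  proof (rule end_hexagon_weight)
    show "degree (chain_graph H n) v = (if v = s 2 then 4 else 2)" if "v \<in> verts (H 1)" for v
      using degree_chain[OF _ _ that, of n] assms by (simp add: eval_nat_numeral)
  qed (use chain_hexagon[of 1] cut_vertex_mem(1)[of 1] in \<open>simp_all add: eval_nat_numeral\<close>)
  have last: "w n = 2 + sqrt 2 / 2"
    unfolding w_def
  proof (rule end_hexagon_weight)
    show "degree (chain_graph H n) v = (if v = s n then 4 else 2)" if "v \<in> verts (H n)" for v
      using degree_chain[OF _ _ that, of n] assms by simp
  qed (use assms chain_hexagon[of n] cut_vertex_mem(2)[of n] in simp_all)
  have inner: "w k = 1 + sqrt 2 + (3 / 4 - sqrt 2 / 2) * of_bool (attach_dist H s (Suc k) = 1)"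
    if k: "k \<in> {2..<n}" for k
  proof -
    have hex: "hexagon (H k)" and sk: "s k \<in> verts (H k)" "s (Suc k) \<in> verts (H k)" "s k \<noteq> s (Suc k)"
      using k cut_vertices_distinct[of k] by (auto intro: chain_hexagon cut_vertex_mem)
    have "degree (chain_graph H n) v = (if v = s k \<or> v = s (Suc k) then 4 else 2)"
      if "v \<in> verts (H k)" for v
      using degree_chain[OF _ _ that, of n] k by simp
    then have "w k = 1 + sqrt 2 + (if {s k, s (Suc k)} \<in> edges (H k) then 3 / 4 - sqrt 2 / 2 else 0)"
      unfolding w_def by (intro inner_hexagon_weight hex sk)
    then show ?thesis
      using hexagon_dist_1_iff[OF hex sk] by (simp add: attach_dist_def)
  qed
  have "real (card {k \<in> {3..n}. attach_dist H s k = 1}) =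
      (\<Sum>k\<in>{3..n}. of_bool (attach_dist H s k = 1))"
    by (simp add: of_bool_def sum.If_cases Int_def)
  also have "\<dots> = (\<Sum>k\<in>{Suc 2..<Suc n}. of_bool (attach_dist H s k = 1))"
    by (rule sum.cong) auto
  also have "\<dots> = (\<Sum>k\<in>{2..<n}. of_bool (attach_dist H s (Suc k) = 1))"
    by (rule sum.shift_bounds_Suc_ivl)
  finally have count: "(\<Sum>k\<in>{2..<n}. of_bool (attach_dist H s (Suc k) = 1)) =
      real (card {k \<in> {3..n}. attach_dist H s k = 1})" ..
  have "{1..n} = {1, n} \<union> {2..<n}"
    using assms by auto
  then have "randic_index (chain_graph H n) = w 1 + w n + (\<Sum>k\<in>{2..<n}. w k)"
    unfolding randic_chain_sum w_def[symmetric] using assms by (simp add: add.assoc)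
  also have "(\<Sum>k\<in>{2..<n}. w k) = (\<Sum>k\<in>{2..<n}.
      1 + sqrt 2 + (3 / 4 - sqrt 2 / 2) * of_bool (attach_dist H s (Suc k) = 1))"
    by (intro sum.cong refl inner)
  also have "\<dots> = (1 + sqrt 2) * (real n - 2) +
      (3 / 4 - sqrt 2 / 2) * real (card {k \<in> {3..n}. attach_dist H s k = 1})"
    unfolding sum.distrib sum_distrib_left[symmetric] count using assms
    by (simp add: of_nat_diff algebra_simps)
  finally show ?thesis
    unfolding first last by (simp add: algebra_simps)
qed

end

section \<open>Counting independent events of equal probability\<close>
context prob_space
begin

text \<open>By independence, the probability that exactly the events in \<open>J\<close> occur is a product of factors
  \<open>p\<close> and \<open>1 - p\<close>.\<close>
lemma prob_indicator_pattern:
  assumes "indep_vars (\<lambda>_. count_space UNIV) Y I" "finite I" "J \<subseteq> I"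
    and p: "\<And>i. i \<in> I \<Longrightarrow> prob {\<omega> \<in> space M. Y i \<omega>} = p"
  shows "{\<omega> \<in> space M. {i \<in> I. Y i \<omega>} = J} \<in> events"
    and "prob {\<omega> \<in> space M. {i \<in> I. Y i \<omega>} = J} = p ^ card J * (1 - p) ^ (card I - card J)"
proof -
  have rv [measurable]: "Y i \<in> measurable M (count_space UNIV)" if "i \<in> I" for i
    using assms(1) that by (auto simp: indep_vars_def)
  have meas: "{\<omega> \<in> space M. Y i \<omega>} \<in> events" if "i \<in> I" for i
    using that by measurable
  define B where "B i = Y i -` {i \<in> J} \<inter> space M" for i
  have B: "B i \<in> events" "prob (B i) = (if i \<in> J then p else 1 - p)" if "i \<in> I" for i
  proof -
    show "B i \<in> events"
      unfolding B_def using rv[OF that] by (rule measurable_sets) simp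
    have "B i = (if i \<in> J then {\<omega> \<in> space M. Y i \<omega>} else space M - {\<omega> \<in> space M. Y i \<omega>})"
      by (auto simp: B_def)
    then show "prob (B i) = (if i \<in> J then p else 1 - p)"
      using prob_compl[OF meas[OF that]] p[OF that] by simp
  qed
  \<comment> \<open>An empty intersection would be the whole type, not the sample space.\<close>
  have eq: "{\<omega> \<in> space M. {i \<in> I. Y i \<omega>} = J} = (if I = {} then space M else (\<Inter>i\<in>I. B i))"
    using assms(3) by (auto simp: B_def)
  show "{\<omega> \<in> space M. {i \<in> I. Y i \<omega>} = J} \<in> events"
    unfolding eq using B(1) assms(2) by (auto intro: sets.finite_INT)
  show "prob {\<omega> \<in> space M. {i \<in> I. Y i \<omega>} = J} = p ^ card J * (1 - p) ^ (card I - card J)"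
  proof (cases "I = {}")
    case True
    then show ?thesis using assms(3) by (simp add: eq prob_space)
  next
    case False
    have "prob (\<Inter>i\<in>I. B i) = (\<Prod>i\<in>I. prob (B i))"
      unfolding B_def by (rule indep_varsD_finite[OF assms(1) False assms(2)]) simp
    also have "\<dots> = (\<Prod>i\<in>I. if i \<in> J then p else 1 - p)"
      using B(2) by simp
    also have "\<dots> = p ^ card (I \<inter> J) * (1 - p) ^ card (I - J)"
      using assms(2) by (simp add: prod.If_cases Diff_eq)
    also have "\<dots> = p ^ card J * (1 - p) ^ (card I - card J)"
      using assms(2,3) by (simp add: Int_absorb1 card_Diff_subset finite_subset)
    finally show ?thesis using False by (simp add: eq)
  qed
qed

text \<open>The event that \<open>k\<close> of the \<open>Y i\<close> hold splits over the \<open>k\<close>-subsets of \<open>I\<close> that can be the set of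
  successes. All these subsets have the same probability, and their number is the binomial
  coefficient.\<close>
theorem distr_card_indep_binomial:
  assumes indep: "indep_vars (\<lambda>_. count_space UNIV) Y I" and fin: "finite I"
    and p01: "0 \<le> p" "p \<le> 1"
    and p: "\<And>i. i \<in> I \<Longrightarrow> prob {\<omega> \<in> space M. Y i \<omega>} = p"
  shows "(\<lambda>\<omega>. card {i \<in> I. Y i \<omega>}) \<in> measurable M (count_space UNIV)"
    and "distr M (count_space UNIV) (\<lambda>\<omega>. card {i \<in> I. Y i \<omega>}) = measure_pmf (binomial_pmf (card I) p)"
proof -
  let ?X = "\<lambda>\<omega>. card {i \<in> I. Y i \<omega>}"
  let ?J = "\<lambda>k. {J. J \<subseteq> I \<and> card J = k}"
  have finJ: "finite (?J k)" for k
    using fin by simp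
  have fibre: "?X -` {k} \<inter> space M = (\<Union>J\<in>?J k. {\<omega> \<in> space M. {i \<in> I. Y i \<omega>} = J})" for k
    by auto
  have ev: "?X -` {k} \<inter> space M \<in> events" for k
    unfolding fibre using prob_indicator_pattern(1)[OF indep fin _ p] finJ
    by (intro sets.finite_UN) auto
  show X: "?X \<in> measurable M (count_space UNIV)"
    using ev by (simp add: measurable_count_space_eq_countable)
  have prob: "prob (?X -` {k} \<inter> space M) = pmf (binomial_pmf (card I) p) k" for k
  proof -
    have "prob (?X -` {k} \<inter> space M) =
        (\<Sum>J\<in>?J k. prob {\<omega> \<in> space M. {i \<in> I. Y i \<omega>} = J})"
      unfolding fibre
    proof (rule finite_measure_finite_Union)
      show "(\<lambda>J. {\<omega> \<in> space M. {i \<in> I. Y i \<omega>} = J}) ` ?J k \<subseteq> events"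
        using prob_indicator_pattern(1)[OF indep fin _ p] by auto
    qed (use finJ in \<open>auto simp: disjoint_family_on_def\<close>)
    also have "\<dots> = (\<Sum>J\<in>?J k. p ^ k * (1 - p) ^ (card I - k))"
      using prob_indicator_pattern(2)[OF indep fin _ p] by (intro sum.cong) auto
    finally show ?thesis
      using p01 n_subsets[OF fin] by simp
  qed
  show "distr M (count_space UNIV) ?X = measure_pmf (binomial_pmf (card I) p)"
    by (rule measure_eqI_countable[of _ UNIV])
      (simp_all add: emeasure_distr[OF X] emeasure_eq_measure prob emeasure_pmf_single)
qed

end

text \<open>The binomial probabilities are the values of the Bernstein polynomials at \<open>p\<close>, whose first and
  second factorial moments are known.\<close>
lemma binomial_moments:
  assumes "0 \<le> p" "p \<le> 1"
  shows "measure_pmf.expectation (binomial_pmf n p) real = real n * p"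
    and "measure_pmf.expectation (binomial_pmf n p) (\<lambda>k. (real k)\<^sup>2) =
      (real n * p)\<^sup>2 + real n * p * (1 - p)"
proof -
  have E: "measure_pmf.expectation (binomial_pmf n p) f = (\<Sum>k\<le>n. f k * Bernstein n k p)" for f :: "nat \<Rightarrow> real"
    using assms by (simp add: expectation_binomial_pmf' Bernstein_def mult_ac)
  show "measure_pmf.expectation (binomial_pmf n p) real = real n * p"
    unfolding E by simp
  have "(\<Sum>k\<le>n. (real k)\<^sup>2 * Bernstein n k p) =
      (\<Sum>k\<le>n. real k * (real k - 1) * Bernstein n k p) + (\<Sum>k\<le>n. real k * Bernstein n k p)"
    by (simp only: flip: sum.distrib) (simp add: algebra_simps power2_eq_square)
  then show "measure_pmf.expectation (binomial_pmf n p) (\<lambda>k. (real k)\<^sup>2) =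
      (real n * p)\<^sup>2 + real n * p * (1 - p)"
    unfolding E by (simp only: sum_k_Bernstein sum_kk_Bernstein)
      (simp add: algebra_simps power2_eq_square)
qed

text \<open>Any integral of a function of \<open>X\<close> is an integral over its law, so only the first two moments of
  the binomial distribution enter.\<close>
lemma (in prob_space) affine_binomial_moments:
  fixes a c :: real
  assumes X: "X \<in> measurable M (count_space UNIV)"
    and distr: "distr M (count_space UNIV) X = measure_pmf (binomial_pmf n p)"
    and p: "0 \<le> p" "p \<le> 1"
  shows "integrable M (\<lambda>\<omega>. a + c * real (X \<omega>))"
    and "expectation (\<lambda>\<omega>. a + c * real (X \<omega>)) = a + c * (real n * p)"
    and "variance (\<lambda>\<omega>. a + c * real (X \<omega>)) = c\<^sup>2 * p * (1 - p) * real n"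
proof -
  have int: "integrable M (\<lambda>\<omega>. f (X \<omega>))"
    and ex: "expectation (\<lambda>\<omega>. f (X \<omega>)) = measure_pmf.expectation (binomial_pmf n p) f"
    for f :: "nat \<Rightarrow> real"
    using integrable_distr_eq[OF X, of f] integral_distr[OF X, of f] p by (simp_all add: distr)
  show "integrable M (\<lambda>\<omega>. a + c * real (X \<omega>))"
    by (rule int)
  show mean: "expectation (\<lambda>\<omega>. a + c * real (X \<omega>)) = a + c * (real n * p)"
    using int[of real] ex[of real] binomial_moments(1)[OF p, of n] by (simp add: prob_space)
  have "variance (\<lambda>\<omega>. a + c * real (X \<omega>)) =
      expectation (\<lambda>\<omega>. c\<^sup>2 * (real (X \<omega>))\<^sup>2 - 2 * c\<^sup>2 * (real n * p) * real (X \<omega>) + c\<^sup>2 * (real n * p)\<^sup>2)"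
    unfolding mean by (simp add: algebra_simps power2_eq_square)
  also have "\<dots> = c\<^sup>2 * ((real n * p)\<^sup>2 + real n * p * (1 - p)) - 2 * c\<^sup>2 * (real n * p) * (real n * p)
      + c\<^sup>2 * (real n * p)\<^sup>2"
    using int[of real] int[of "\<lambda>k. (real k)\<^sup>2"] ex[of real] ex[of "\<lambda>k. (real k)\<^sup>2"]
      binomial_moments[OF p, of n] by (simp add: prob_space)
  also have "\<dots> = c\<^sup>2 * p * (1 - p) * real n"
    by (simp add: algebra_simps power2_eq_square)
  finally show "variance (\<lambda>\<omega>. a + c * real (X \<omega>)) = c\<^sup>2 * p * (1 - p) * real n" .
qed

text \<open>The count is a sum of independent indicators with mean \<open>p\<close> and variance \<open>p * (1 - p)\<close>. Their
  common law is determined by \<open>p\<close>, so the central limit theorem for independent, identically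
  distributed variables applies.\<close>
lemma (in prob_space) de_Moivre_Laplace:
  assumes indep: "indep_vars (\<lambda>_. count_space UNIV) Y (UNIV :: nat set)"
    and p: "0 < p" "p < 1"
    and prob: "\<And>i. prob {\<omega> \<in> space M. Y i \<omega>} = p"
  shows "weak_conv_m (\<lambda>n. distr M borel
    (\<lambda>\<omega>. (real (card {i \<in> {..<n}. Y i \<omega>}) - real n * p) / sqrt (real n * (p * (1 - p)))))
    std_normal_distribution"
proof -
  define B where "B i \<omega> = (of_bool (Y i \<omega>) :: real)" for i \<omega>
  have rv: "Y i \<in> measurable M (count_space UNIV)" for i
    using indep by (auto simp: indep_vars_def)
  have ev: "{\<omega> \<in> space M. Y i \<omega>} \<in> events" for i
    using rv[of i] by measurable
  have B_ind: "B i \<omega> = indicator {\<omega> \<in> space M. Y i \<omega>} \<omega>" if "\<omega> \<in> space M" for i \<omega>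
    using that by (simp add: B_def indicator_def)
  have mean: "expectation (B i) = p" for i
    using ev[of i] prob[of i] by (simp add: B_ind cong: Bochner_Integration.integral_cong)
  have int: "integrable M (B i)" for i
    using ev[of i] by (simp add: B_ind integrable_indicator_iff emeasure_eq_measure cong: Bochner_Integration.integrable_cong)
  have B2: "(B i \<omega>)\<^sup>2 = B i \<omega>" for i \<omega>
    by (simp add: B_def)
  have var: "variance (B i) = p * (1 - p)" for i
  proof -
    have "variance (B i) = expectation (\<lambda>\<omega>. (B i \<omega>)\<^sup>2) - (expectation (B i))\<^sup>2"
      by (rule variance_eq) (simp_all add: B2 int)
    then show ?thesis
      by (simp add: B2 mean) (simp add: power2_eq_square algebra_simps)
  qed
  have indB: "indep_vars (\<lambda>_. borel) B UNIV"
    unfolding B_def[abs_def] by (rule indep_vars_compose2[OF indep]) simp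
  have rvB: "B i \<in> borel_measurable M" for i
    using int by (rule borel_measurable_integrable)
  have same: "distr M borel (B i) = distr M borel (B 0)" for i
  proof (rule measure_eqI)
    fix A assume "A \<in> sets (distr M borel (B i))"
    then have A: "A \<in> sets borel" by simp
    \<comment> \<open>The right-hand side does not depend on \<open>j\<close>, which is all that is needed.\<close>
    have "emeasure M (B j -` A \<inter> space M) = (if 1 \<in> A then p else 0) + (if 0 \<in> A then 1 - p else 0)" for j
    proof -
      have "B j -` A \<inter> space M = (if 1 \<in> A then {\<omega> \<in> space M. Y j \<omega>} else {}) \<union>
          (if 0 \<in> A then space M - {\<omega> \<in> space M. Y j \<omega>} else {})"
        by (auto simp: B_def of_bool_def split: if_splits)
      moreover have "{\<omega> \<in> space M. Y j \<omega>} \<union> space M = space M"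
        by auto
      ultimately show ?thesis
        using ev[of j] prob[of j] p prob_compl[OF ev[of j]]
        by (auto simp: emeasure_eq_measure prob_space simp flip: ennreal_plus)
    qed
    then show "emeasure (distr M borel (B i)) A = emeasure (distr M borel (B 0)) A"
      using A rvB by (simp add: emeasure_distr)
  qed simp
  have "weak_conv_m (\<lambda>n. distr M borel
      (\<lambda>\<omega>. (\<Sum>i<n. B i \<omega> - p) / sqrt (real n * (sqrt (p * (1 - p)))\<^sup>2))) std_normal_distribution"
  proof (rule central_limit_theorem[OF indB mean])
    show "0 < sqrt (p * (1 - p))"
      using p by simp
    show "integrable M (\<lambda>\<omega>. (B n \<omega>)\<^sup>2)" for n
      by (simp add: B2 int)
    show "variance (B n) = (sqrt (p * (1 - p)))\<^sup>2" for n
      using p by (simp add: var)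
  qed (rule same)
  moreover have "(\<Sum>i<n. B i \<omega> - p) = real (card {i \<in> {..<n}. Y i \<omega>}) - real n * p" for n \<omega>
    by (simp add: B_def sum_subtractf of_bool_def sum.If_cases Int_def)
  ultimately show ?thesis
    using p by simp
qed

text \<open>The standardised index of a chain with \<open>n + 2\<close> hexagons involves \<open>n\<close> random attachments; this
  removes the shift, and with it the degenerate indices below \<open>2\<close>.\<close>
lemma weak_conv_m_offset:
  "weak_conv_m (\<lambda>n. \<mu> (n + k)) \<nu> \<Longrightarrow> weak_conv_m \<mu> \<nu>"
  unfolding weak_conv_m_def weak_conv_def
  by (blast intro: LIMSEQ_offset)

text \<open>The random attachments are numbered from \<open>3\<close>, whereas the central limit theorem wants a family
  indexed by all natural numbers.\<close>
lemma (in prob_space) indep_vars_reindex: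
  assumes indep: "indep_vars N X I" and f: "inj_on f J" "f ` J \<subseteq> I"
  shows "indep_vars (\<lambda>j. N (f j)) (\<lambda>j. X (f j)) J"
  unfolding indep_vars_def2
proof (intro conjI ballI indep_setsI)
  let ?F = "\<lambda>i. {X i -` A \<inter> space M |A. A \<in> sets (N i)}"
  show rv: "random_variable (N (f j)) (X (f j))" if "j \<in> J" for j
    using indep f that by (auto simp: indep_vars_def2)
  show "?F (f j) \<subseteq> events" if "j \<in> J" for j
    using rv[OF that] by (auto intro: measurable_sets)
  fix A K
  assume K: "K \<noteq> {}" "K \<subseteq> J" "finite K" "\<forall>j\<in>K. A j \<in> ?F (f j)"
  have inj: "inj_on f K"
    using f(1) K(2) by (rule inj_on_subset)
  define A' where "A' = A \<circ> inv_into K f"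
  have A': "A' (f j) = A j" if "j \<in> K" for j
    using that inj by (simp add: A'_def inv_into_f_f)
  have "indep_sets ?F I"
    using indep by (simp add: indep_vars_def2)
  then have "prob (\<Inter>i\<in>f ` K. A' i) = (\<Prod>i\<in>f ` K. prob (A' i))"
  proof (rule indep_setsD)
    show "f ` K \<subseteq> I"
      using K(2) f(2) by blast
    show "\<forall>i\<in>f ` K. A' i \<in> ?F i"
      using K(4) by (simp add: A')
  qed (use K in simp_all)
  moreover have "(\<Inter>i\<in>f ` K. A' i) = (\<Inter>j\<in>K. A j)"
    by (simp add: A')
  moreover have "(\<Prod>i\<in>f ` K. prob (A' i)) = (\<Prod>j\<in>K. prob (A j))"
    using inj by (simp add: prod.reindex A')
  ultimately show "prob (\<Inter>j\<in>K. A j) = (\<Prod>j\<in>K. prob (A j))"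
    by simp
qed

section \<open>The random spiro chain\<close>
theorem corollary4:
  fixes M :: "'a measure" and p1 p2 p3 :: real
    and H :: "nat \<Rightarrow> 'a \<Rightarrow> 'v graph" and s :: "nat \<Rightarrow> 'a \<Rightarrow> 'v"
    and R :: "nat \<Rightarrow> 'a \<Rightarrow> real"
  assumes "random_spiro_chain M p1 p2 p3 H s"
    and "\<And>n \<omega>. R n \<omega> = randic_index (RSC H n \<omega>)"
  shows "(\<forall>n\<ge>2.
            (\<exists>X. X \<in> measurable M (count_space UNIV) \<and>
                 distr M (count_space UNIV) X = measure_pmf (binomial_pmf (n - 2) p1) \<and>
                 (\<forall>\<omega>\<in>space M. R n \<omega> =
                    2 - sqrt 2 + (3 / 4 - sqrt 2 / 2) * real (X \<omega>) + (1 + sqrt 2) * real n)) \<and>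
            integrable M (R n) \<and>
            prob_space.expectation M (R n) =
              2 - sqrt 2 + ((3 / 4 - sqrt 2 / 2) * p1 + 1 + sqrt 2) * real n
                + (sqrt 2 - 3 / 2) * p1 \<and>
            prob_space.variance M (R n) =
              (3 / 4 - sqrt 2 / 2)\<^sup>2 * p1 * (1 - p1) * (real n - 2)) \<and>
         weak_conv_m
           (\<lambda>n. distr M borel
              (\<lambda>\<omega>. (R n \<omega> - prob_space.expectation M (R n)) / sqrt (prob_space.variance M (R n))))
           std_normal_distribution"
proof -
  interpret random_spiro_chain M p1 p2 p3 H s
    by (rule assms(1))
  define c where "c = 3 / 4 - sqrt 2 / 2"
  define Y where "Y k \<omega> \<longleftrightarrow> attach_dist (\<lambda>k. H k \<omega>) (\<lambda>k. s k \<omega>) k = 1" for k \<omega>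
  define X where "X n \<omega> = card {k \<in> {3..n}. Y k \<omega>}" for n \<omega>
  have indepY: "indep_vars (\<lambda>_. count_space UNIV) Y {3..}"
    unfolding Y_def[abs_def] by (rule indep_vars_compose2[OF indep, where Y = "\<lambda>_ d. d = 1"]) simp
  have probY: "prob {\<omega> \<in> space M. Y k \<omega>} = p1" if "3 \<le> k" for k
    unfolding Y_def by (rule prob1[OF that])
  have X: "X n \<in> measurable M (count_space UNIV)"
    "distr M (count_space UNIV) (X n) = measure_pmf (binomial_pmf (n - 2) p1)" for n
  proof -
    have indep_n: "indep_vars (\<lambda>_. count_space UNIV) Y {3..n}"
      by (rule indep_vars_subset[OF indepY]) auto
    have prob_n: "prob {\<omega> \<in> space M. Y k \<omega>} = p1" if "k \<in> {3..n}" for k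
      using probY that by simp
    have p01: "0 \<le> p1" "p1 \<le> 1"
      using p1 by simp_all
    note law = distr_card_indep_binomial[OF indep_n finite_atLeastAtMost p01 prob_n]
    have "X n = (\<lambda>\<omega>. card {k \<in> {3..n}. Y k \<omega>})" "card {3..n} = n - 2"
      by (simp_all add: X_def fun_eq_iff)
    with law show "X n \<in> measurable M (count_space UNIV)"
      "distr M (count_space UNIV) (X n) = measure_pmf (binomial_pmf (n - 2) p1)"
      by (simp_all only:)
  qed
  have R: "R n \<omega> = (2 - sqrt 2 + (1 + sqrt 2) * real n) + c * real (X n \<omega>)"
    if "2 \<le> n" "\<omega> \<in> space M" for n \<omega>
    using randic_index_chain[OF chain[OF that(2)] that(1)]
    by (simp add: assms(2) RSC_def X_def Y_def c_def)
  have moments: "integrable M (R n)"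
    "expectation (R n) = 2 - sqrt 2 + (1 + sqrt 2) * real n + c * (real (n - 2) * p1)"
    "variance (R n) = c\<^sup>2 * p1 * (1 - p1) * real (n - 2)" if n: "2 \<le> n" for n
  proof -
    note mom = affine_binomial_moments[OF X[of n], where a = "2 - sqrt 2 + (1 + sqrt 2) * real n" and c = c]
    show "integrable M (R n)"
      using mom(1) p1 by (simp add: R[OF n] cong: Bochner_Integration.integrable_cong)
    show E: "expectation (R n) = 2 - sqrt 2 + (1 + sqrt 2) * real n + c * (real (n - 2) * p1)"
      using mom(2) p1 by (simp add: R[OF n] cong: Bochner_Integration.integral_cong)
    show "variance (R n) = c\<^sup>2 * p1 * (1 - p1) * real (n - 2)"
      using mom(2,3) p1 unfolding E
      by (simp add: R[OF n] cong: Bochner_Integration.integral_cong)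
  qed
  have finite_n: "(\<exists>X. X \<in> measurable M (count_space UNIV) \<and>
                 distr M (count_space UNIV) X = measure_pmf (binomial_pmf (n - 2) p1) \<and>
                 (\<forall>\<omega>\<in>space M. R n \<omega> =
                    2 - sqrt 2 + (3 / 4 - sqrt 2 / 2) * real (X \<omega>) + (1 + sqrt 2) * real n)) \<and>
            integrable M (R n) \<and>
            expectation (R n) =
              2 - sqrt 2 + ((3 / 4 - sqrt 2 / 2) * p1 + 1 + sqrt 2) * real n
                + (sqrt 2 - 3 / 2) * p1 \<and>
            variance (R n) = (3 / 4 - sqrt 2 / 2)\<^sup>2 * p1 * (1 - p1) * (real n - 2)"
    if n: "2 \<le> n" for n
  proof (intro conjI)
    show "\<exists>X. X \<in> measurable M (count_space UNIV) \<and>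
                 distr M (count_space UNIV) X = measure_pmf (binomial_pmf (n - 2) p1) \<and>
                 (\<forall>\<omega>\<in>space M. R n \<omega> =
                    2 - sqrt 2 + (3 / 4 - sqrt 2 / 2) * real (X \<omega>) + (1 + sqrt 2) * real n)"
      by (rule exI[of _ "X n"]) (simp add: X R[OF n] c_def)
    show "expectation (R n) = 2 - sqrt 2 + ((3 / 4 - sqrt 2 / 2) * p1 + 1 + sqrt 2) * real n
                + (sqrt 2 - 3 / 2) * p1"
      unfolding moments(2)[OF n] c_def using n by (simp add: of_nat_diff algebra_simps)
    show "variance (R n) = (3 / 4 - sqrt 2 / 2)\<^sup>2 * p1 * (1 - p1) * (real n - 2)"
      unfolding moments(3)[OF n] c_def using n by (simp add: of_nat_diff)
  qed (rule moments(1)[OF n])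
  \<comment> \<open>With a negative slope the standardised index would be minus the standardised count.\<close>
  have "sqrt 2 < 3 / 2"
    by (rule real_less_lsqrt) (simp_all add: power2_eq_square)
  then have c: "0 < c"
    by (simp add: c_def)
  have "indep_vars (\<lambda>_. count_space UNIV) (\<lambda>i. Y (i + 3)) UNIV"
    by (rule indep_vars_reindex[OF indepY, where f = "\<lambda>i. i + 3"]) auto
  then have "weak_conv_m (\<lambda>n. distr M borel
      (\<lambda>\<omega>. (real (card {i \<in> {..<n}. Y (i + 3) \<omega>}) - real n * p1) / sqrt (real n * (p1 * (1 - p1)))))
      std_normal_distribution"
    by (rule de_Moivre_Laplace) (use p1 probY in auto)
  moreover have "distr M borel (\<lambda>\<omega>. (R (n + 2) \<omega> - expectation (R (n + 2))) / sqrt (variance (R (n + 2)))) =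
      distr M borel
      (\<lambda>\<omega>. (real (card {i \<in> {..<n}. Y (i + 3) \<omega>}) - real n * p1) / sqrt (real n * (p1 * (1 - p1))))" for n
  proof (intro distr_cong refl)
    fix \<omega> assume \<omega>: "\<omega> \<in> space M"
    have "{k \<in> {3..n + 2}. Y k \<omega>} = (\<lambda>i. i + 3) ` {i \<in> {..<n}. Y (i + 3) \<omega>}"
    proof (intro equalityI subsetI)
      fix k assume "k \<in> {k \<in> {3..n + 2}. Y k \<omega>}"
      then show "k \<in> (\<lambda>i. i + 3) ` {i \<in> {..<n}. Y (i + 3) \<omega>}"
        by (intro image_eqI[of _ _ "k - 3"]) auto
    qed auto
    then have count: "X (n + 2) \<omega> = card {i \<in> {..<n}. Y (i + 3) \<omega>}"
      by (simp add: X_def card_image)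
    have n: "2 \<le> n + 2" by simp
    have "R (n + 2) \<omega> - expectation (R (n + 2)) = c * (real (X (n + 2) \<omega>) - real n * p1)"
      unfolding moments(2)[OF n] R[OF n \<omega>] by (simp add: algebra_simps)
    moreover have "variance (R (n + 2)) = c\<^sup>2 * (real n * (p1 * (1 - p1)))"
      unfolding moments(3)[OF n] by simp
    then have "sqrt (variance (R (n + 2))) = c * sqrt (real n * (p1 * (1 - p1)))"
      using c by (simp only: real_sqrt_mult[of "c\<^sup>2"]) simp
    ultimately show "(R (n + 2) \<omega> - expectation (R (n + 2))) / sqrt (variance (R (n + 2))) =
        (real (card {i \<in> {..<n}. Y (i + 3) \<omega>}) - real n * p1) / sqrt (real n * (p1 * (1 - p1)))"
      using c by (simp only: count) simp
  qed
  ultimately have "weak_conv_m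
           (\<lambda>n. distr M borel (\<lambda>\<omega>. (R (n + 2) \<omega> - expectation (R (n + 2))) / sqrt (variance (R (n + 2)))))
           std_normal_distribution"
    by (simp only:)
  then have "weak_conv_m
           (\<lambda>n. distr M borel (\<lambda>\<omega>. (R n \<omega> - expectation (R n)) / sqrt (variance (R n))))
           std_normal_distribution"
    by (rule weak_conv_m_offset)
  with finite_n show ?thesis
    by blast
qed

end
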